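(* Let $\mathbb{Z}[i]$ be the ring of Gaussian integers and let $\langle x_n\rangle_{n=1}^\infty$ be a sequence in $\mathbb{Z}[i]$. In the semigroup $(\mathbb{Z}[i],+)$ the following conditions are equivalent: (1) $\langle x_n\rangle_{n=1}^\infty$ is an almost minimal sequence; (2) $FS(\langle x_n\rangle_{n=1}^\infty)$ is a $J$-set; (3) there is an idempotent $p\in(\beta\mathbb{Z}[i],+)$ with $p\in\bigcap_{m=1}^\infty\overline{FS(\langle x_n\rangle_{n=m}^\infty)}\cap J(\mathbb{Z}[i])$.
   Context: For a discrete commutative semigroup $(S,+)$, $\beta S$ is the set of ultrafilters on $S$ (principal ultrafilters identified with points of $S$), with the extended operation given by $A\in p+q$ iff $\{x\in S:-x+A\in q\}\in p$, where $-x+A=\{y\in S: x+y\in A\}$; this makes $\beta S$ a compact right topological semigroup. For $A\subseteq S$, $\overline{A}=\{p\in\beta S: A\in p\}$. For a sequence $\langle x_n\rangle$ in $S$ and $m\in\mathbb{N}$, $FS(\langle x_n\rangle_{n=m}^\infty)=\{\sum_{n\in F}x_n: F \text{ a finite nonempty subset of } \{m,m+1,\dots\}\}$. Let $\mathcal{P}_f(X)$ denote the finite nonempty subsets of $X$ and ${}^{\mathbb{N}}S$ the set of sequences in $S$. A set $A\subseteq S$ is a $J$-set if for every $F\in\mathcal{P}_f({}^{\mathbb{N}}S)$ there exist $a\in S$ and $H\in\mathcal{P}_f(\mathbb{N})$ such that $a+\sum_{t\in H}f(t)\in A$ for all $f\in F$. $J(S)=\{p\in\beta S: \text{every } A\in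 p \text{ is a } J\text{-set}\}$. A sequence $\langle x_n\rangle_{n=1}^\infty$ in $S$ is almost minimal if $\bigcap_{m=1}^\infty\overline{FS(\langle x_n\rangle_{n=m}^\infty)}\cap J(S)\neq\emptyset$. *)

theory Defs
  imports Complex_Main
begin

section \<open>The Gaussian integers\<close>

typedef gauss_int = "{z :: complex. Re z \<in> \<int> \<and> Im z \<in> \<int>}"
  morphisms complex_of_gauss_int Abs_gauss_int
  by (rule exI[of _ 0]) simp

setup_lifting type_definition_gauss_int

instantiation gauss_int :: comm_ring_1
begin

lift_definition zero_gauss_int :: gauss_int is 0
  by simp

lift_definition one_gauss_int :: gauss_int is 1
  by simp

lift_definition plus_gauss_int :: "gauss_int \<Rightarrow> gauss_int \<Rightarrow> gauss_int" is "(+)"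
  by simp

lift_definition uminus_gauss_int :: "gauss_int \<Rightarrow> gauss_int" is uminus
  by simp

lift_definition minus_gauss_int :: "gauss_int \<Rightarrow> gauss_int \<Rightarrow> gauss_int" is "(-)"
  by simp

lift_definition times_gauss_int :: "gauss_int \<Rightarrow> gauss_int \<Rightarrow> gauss_int" is "(*)"
  by simp

instance
  by standard (transfer; simp add: algebra_simps; fail)+

end


section \<open>The semigroup of ultrafilters\<close>

text \<open>
  A filter \<open>p\<close> is represented by the library type; \<open>A \<in> p\<close> is rendered as
  \<open>\<forall>\<^sub>F x in p. x \<in> A\<close>. The library type includes the improper filter \<open>bot\<close>,
  which an ultrafilter must exclude.
\<close>

definition ultrafilter :: "'a filter \<Rightarrow> bool" where
  "ultrafilter p \<longleftrightarrow>
     p \<noteq> bot \<and> (\<forall>A. (\<forall>\<^sub>F x in p. x \<in> A) \<or> (\<forall>\<^sub>F x in p. x \<in> - A))"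

definition beta :: "'a filter set" where
  "beta = {p. ultrafilter p}"

definition beta_closure :: "'a set \<Rightarrow> 'a filter set" where
  "beta_closure A = {p \<in> beta. \<forall>\<^sub>F x in p. x \<in> A}"

text \<open>The set \<open>-x + A\<close>.\<close>

definition left_shift :: "'a::plus \<Rightarrow> 'a set \<Rightarrow> 'a set" where
  "left_shift x A = {y. x + y \<in> A}"

definition beta_add :: "'a::plus filter \<Rightarrow> 'a filter \<Rightarrow> 'a filter" (infixl "\<oplus>\<^sub>\<beta>" 65) where
  "p \<oplus>\<^sub>\<beta> q =
     Abs_filter (\<lambda>P. \<forall>\<^sub>F x in p. x \<in> {x. \<forall>\<^sub>F y in q. y \<in> left_shift x {z. P z}})"

text \<open>The next two lemmas confirm that the predicate under \<open>Abs_filter\<close> is a filter, so that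
  \<open>A \<in> p + q\<close> iff \<open>{x. -x + A \<in> q} \<in> p\<close>, and that \<open>\<beta>S\<close> is closed under the operation.\<close>

lemma eventually_beta_add:
  "(\<forall>\<^sub>F z in p \<oplus>\<^sub>\<beta> q. z \<in> A) \<longleftrightarrow>
     (\<forall>\<^sub>F x in p. x \<in> {x. \<forall>\<^sub>F y in q. y \<in> left_shift x A})"
proof -
  have "is_filter (\<lambda>P. \<forall>\<^sub>F x in p. x \<in> {x. \<forall>\<^sub>F y in q. y \<in> left_shift x {z. P z}})"
  proof
    show "\<forall>\<^sub>F x in p. x \<in> {x. \<forall>\<^sub>F y in q. y \<in> left_shift x {z. True}}"
      by (simp add: left_shift_def)
  next
    fix P Q
    assume "\<forall>\<^sub>F x in p. x \<in> {x. \<forall>\<^sub>F y in q. y \<in> left_shift x {z. P z}}"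
      and "\<forall>\<^sub>F x in p. x \<in> {x. \<forall>\<^sub>F y in q. y \<in> left_shift x {z. Q z}}"
    then show "\<forall>\<^sub>F x in p. x \<in> {x. \<forall>\<^sub>F y in q. y \<in> left_shift x {z. P z \<and> Q z}}"
      by eventually_elim (auto simp: left_shift_def eventually_conj_iff)
  next
    fix P Q :: "'a \<Rightarrow> bool"
    assume PQ: "\<forall>x. P x \<longrightarrow> Q x"
      and "\<forall>\<^sub>F x in p. x \<in> {x. \<forall>\<^sub>F y in q. y \<in> left_shift x {z. P z}}"
    from this(2) show "\<forall>\<^sub>F x in p. x \<in> {x. \<forall>\<^sub>F y in q. y \<in> left_shift x {z. Q z}}"
      by eventually_elim (use PQ in \<open>auto simp: left_shift_def elim: eventually_mono\<close>)
  qed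
  then show ?thesis
    by (simp add: beta_add_def eventually_Abs_filter)
qed

lemma beta_add_in_beta:
  assumes "p \<in> beta" and "q \<in> beta"
  shows "p \<oplus>\<^sub>\<beta> q \<in> beta"
proof -
  have nb: "p \<noteq> bot" "q \<noteq> bot"
    and up: "\<And>A. (\<forall>\<^sub>F x in p. x \<in> A) \<or> (\<forall>\<^sub>F x in p. x \<in> - A)"
    and uq: "\<And>A. (\<forall>\<^sub>F x in q. x \<in> A) \<or> (\<forall>\<^sub>F x in q. x \<in> - A)"
    using assms by (auto simp: beta_def ultrafilter_def)
  have "\<not> (\<forall>\<^sub>F z in p \<oplus>\<^sub>\<beta> q. z \<in> {})"
    using nb by (simp only: eventually_beta_add) (simp add: left_shift_def)
  then have "p \<oplus>\<^sub>\<beta> q \<noteq> bot"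
    by auto
  moreover have "(\<forall>\<^sub>F z in p \<oplus>\<^sub>\<beta> q. z \<in> A) \<or> (\<forall>\<^sub>F z in p \<oplus>\<^sub>\<beta> q. z \<in> - A)" for A
  proof -
    have "\<forall>\<^sub>F x in p. x \<in> {x. \<forall>\<^sub>F y in q. y \<in> left_shift x (- A)}"
      if "\<forall>\<^sub>F x in p. x \<in> - {x. \<forall>\<^sub>F y in q. y \<in> left_shift x A}"
      using that
    proof eventually_elim
      case (elim x)
      then have "\<forall>\<^sub>F y in q. y \<in> - left_shift x A"
        using uq[of "left_shift x A"] by blast
      moreover have "- left_shift x A = left_shift x (- A)"
        by (auto simp: left_shift_def)
      ultimately show ?case by simp
    qed
    then show ?thesis
      using up[of "{x. \<forall>\<^sub>F y in q. y \<in> left_shift x A}"]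
      by (auto simp only: eventually_beta_add)
  qed
  ultimately show ?thesis
    by (simp add: beta_def ultrafilter_def)
qed


section \<open>Finite sums, J-sets and almost minimal sequences\<close>

text \<open>
  Sequences are indexed by \<open>{1, 2, \<dots>}\<close>; the value at \<open>0\<close> of a function on \<^typ>\<open>nat\<close> is
  never used. The class \<open>comm_monoid_add\<close> is only needed for the library's \<open>sum\<close>;
  all sums below run over nonempty index sets.
\<close>

definition FS :: "(nat \<Rightarrow> 'a::comm_monoid_add) \<Rightarrow> nat \<Rightarrow> 'a set" where
  "FS x m = {\<Sum>n\<in>F. x n | F. finite F \<and> F \<noteq> {} \<and> F \<subseteq> {m..}}"

definition J_set :: "'a::comm_monoid_add set \<Rightarrow> bool" where
  "J_set A \<longleftrightarrow>
     (\<forall>F :: (nat \<Rightarrow> 'a) set. finite F \<and> F \<noteq> {} \<longrightarrow>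
        (\<exists>a. \<exists>H. finite H \<and> H \<noteq> {} \<and> H \<subseteq> {1..} \<and> (\<forall>f\<in>F. a + (\<Sum>t\<in>H. f t) \<in> A)))"

definition J_ultrafilters :: "'a::comm_monoid_add filter set" where
  "J_ultrafilters = {p \<in> beta. \<forall>A. (\<forall>\<^sub>F x in p. x \<in> A) \<longrightarrow> J_set A}"

definition almost_minimal :: "(nat \<Rightarrow> 'a::comm_monoid_add) \<Rightarrow> bool" where
  "almost_minimal x \<longleftrightarrow> (\<Inter>m\<in>{1..}. beta_closure (FS x m)) \<inter> J_ultrafilters \<noteq> {}"

end

theory Submission
  imports Defs "HOL-Library.Countable"
begin

text \<open>
  By the Hales--Jewett theorem, J-sets are partition regular. Since
  \<open>FS x m\<close> is the union of \<open>FS x (m + 1)\<close>, its translate by \<open>x m\<close> and a singleton, and singletons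
  are not J-sets, all tails \<open>FS x m\<close> are J-sets as soon as the first one is. Partition regularity
  then makes the tails, together with the complements of the sets that are not J-sets, generate a
  proper filter \<open>p\<close>. Translation invariance of J-sets gives \<open>p \<oplus>\<^sub>\<beta> p \<le> p\<close>, and
  below every such filter there is an idempotent ultrafilter.
\<close>

section \<open>The Hales--Jewett theorem\<close>

text \<open>A variable word is a list over \<open>'a option\<close> in which \<open>None\<close> is the variable.\<close>

definition subst_letter :: "'a \<Rightarrow> 'a option list \<Rightarrow> 'a list" where
  "subst_letter b v = map (case_option b id) v"

definition variable_words :: "'a set \<Rightarrow> nat \<Rightarrow> 'a option list set" where
  "variable_words L n = {v. length v = n \<and> None \<in> set v \<and> set v \<subseteq> insert None (Some ` L)}"

definition monochromatic_line :: "'a set \<Rightarrow> nat \<Rightarrow> ('a list \<Rightarrow> 'c) \<Rightarrow> bool" where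
  "monochromatic_line L n \<chi> \<longleftrightarrow>
     (\<exists>v\<in>variable_words L n. \<exists>c. \<forall>b\<in>L. \<chi> (subst_letter b v) = c)"

definition words :: "'a set \<Rightarrow> nat \<Rightarrow> 'a list set" where
  "words L n = {w. set w \<subseteq> L \<and> length w = n}"

text \<open>Colour focusing: substituting the new letter \<open>z\<close> takes all the variable words \<open>V ! i\<close> to the
  same word \<open>f\<close>, while their lines over the old alphabet \<open>L\<close> have pairwise distinct colours.\<close>

definition focused :: "'a set \<Rightarrow> 'a \<Rightarrow> nat \<Rightarrow> ('a list \<Rightarrow> 'c) \<Rightarrow> nat \<Rightarrow> bool" where
  "focused L z n \<chi> s \<longleftrightarrow>
     (\<exists>V c f. length V = s \<and> length c = s \<and> distinct c \<and> f \<in> words (insert z L) n \<and>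
        (\<forall>i<s. V ! i \<in> variable_words (insert z L) n \<and> subst_letter z (V ! i) = f \<and>
          (\<forall>b\<in>L. \<chi> (subst_letter b (V ! i)) = c ! i)))"

lemma subst_letter_append [simp]:
  "subst_letter b (u @ v) = subst_letter b u @ subst_letter b v"
  by (simp add: subst_letter_def)

lemma subst_letter_constant [simp]: "subst_letter b (map Some w) = w"
  by (simp add: subst_letter_def comp_def)

lemma length_subst_letter [simp]: "length (subst_letter b v) = length v"
  by (simp add: subst_letter_def)

lemma subst_letter_in_words:
  "v \<in> variable_words L n \<Longrightarrow> b \<in> L \<Longrightarrow> subst_letter b v \<in> words L n"
  by (force simp: variable_words_def words_def subst_letter_def)

lemma variable_words_mono: "L \<subseteq> L' \<Longrightarrow> variable_words L n \<subseteq> variable_words L' n"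
  by (auto simp: variable_words_def)

lemma variable_words_append:
  assumes "u \<in> variable_words L m" and "v \<in> variable_words L n"
  shows "u @ v \<in> variable_words L (m + n)"
  using assms by (auto simp: variable_words_def)

lemma variable_words_append_constant:
  assumes "u \<in> variable_words L m" and "w \<in> words L n"
  shows "u @ map Some w \<in> variable_words L (m + n)"
    and "map Some w @ u \<in> variable_words L (n + m)"
  using assms by (auto simp: variable_words_def words_def)

lemma finite_words: "finite L \<Longrightarrow> finite (words L n)"
  unfolding words_def by (rule finite_lists_length_eq)

text \<open>Prepending \<open>v\<close> to the \<open>s\<close> given words keeps them focused,
  since letters of \<open>L\<close> substituted into the prefix do not affect the colour. One
  further word, \<open>v\<close> followed by the constant word \<open>f\<close>, has the same focus
  and a new colour.\<close>

lemma focused_Suc: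
  assumes v: "v \<in> variable_words L m" and b0: "b0 \<in> L"
    and v_mono: "\<And>b w. b \<in> L \<Longrightarrow> w \<in> words (insert z L) n \<Longrightarrow>
      \<chi> (subst_letter b v @ w) = \<chi> (subst_letter b0 v @ w)"
    and foc: "focused L z n (\<lambda>w. \<chi> (subst_letter b0 v @ w)) s"
    and no_line: "\<not> monochromatic_line (insert z L) (m + n) \<chi>"
  shows "focused L z (m + n) \<chi> (Suc s)"
proof -
  let ?L = "insert z L"
  have v': "v \<in> variable_words ?L m"
    using v variable_words_mono[of L ?L m] by blast
  have b0v: "subst_letter b0 v \<in> words ?L m"
    using subst_letter_in_words[OF v'] b0 by blast
  obtain V c f where V: "length V = s" "length c = s" "distinct c" and f: "f \<in> words ?L n"
    and Vi: "\<And>i. i < s \<Longrightarrow> V ! i \<in> variable_words ?L n"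
    and Vz: "\<And>i. i < s \<Longrightarrow> subst_letter z (V ! i) = f"
    and Vc: "\<And>i b. i < s \<Longrightarrow> b \<in> L \<Longrightarrow>
      \<chi> (subst_letter b0 v @ subst_letter b (V ! i)) = c ! i"
    using foc unfolding focused_def by blast
  \<comment> \<open>If \<open>f\<close> had the colour \<open>c ! i\<close> here, the line of
    \<open>V ! i\<close> would keep this colour at \<open>z\<close> as well, against
    \<open>no_line\<close>.\<close>
  have new: "\<chi> (subst_letter b0 v @ f) \<notin> set c"
  proof
    assume "\<chi> (subst_letter b0 v @ f) \<in> set c"
    then obtain i where i: "i < s" "\<chi> (subst_letter b0 v @ f) = c ! i"
      using V by (metis in_set_conv_nth)
    have "map Some (subst_letter b0 v) @ V ! i \<in> variable_words ?L (m + n)"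
      using variable_words_append_constant(2)[OF Vi b0v] i by blast
    moreover have "\<forall>b\<in>?L. \<chi> (subst_letter b (map Some (subst_letter b0 v) @ V ! i)) = c ! i"
      using Vc Vz i by auto
    ultimately show False
      using no_line unfolding monochromatic_line_def by blast
  qed
  define V' where "V' = (v @ map Some f) # map ((@) v) V"
  define c' where "c' = \<chi> (subst_letter b0 v @ f) # c"
  have "V' ! i \<in> variable_words ?L (m + n) \<and> subst_letter z (V' ! i) = subst_letter z v @ f \<and>
      (\<forall>b\<in>L. \<chi> (subst_letter b (V' ! i)) = c' ! i)" if "i < Suc s" for i
  proof (cases i)
    case 0
    then show ?thesis
      using variable_words_append_constant(1)[OF v' f] v_mono f by (simp add: V'_def c'_def)
  next
    case (Suc j)
    then have j: "j < s" using that by simp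
    have "\<chi> (subst_letter b v @ subst_letter b (V ! j)) = c ! j" if "b \<in> L" for b
      using v_mono[OF that] subst_letter_in_words[OF Vi[OF j]] Vc[OF j that] that by simp
    then show ?thesis
      using Suc j V variable_words_append[OF v' Vi[OF j]] Vz[OF j]
      by (simp add: V'_def c'_def)
  qed
  moreover have "subst_letter z v @ f \<in> words ?L (m + n)"
    using subst_letter_in_words[OF v', of z] f by (auto simp: words_def)
  ultimately show ?thesis
    unfolding focused_def
    by (intro exI[of _ V'] exI[of _ c'] exI[of _ "subst_letter z v @ f"])
      (use V new in \<open>auto simp: V'_def c'_def\<close>)
qed

text \<open>Outer induction on the alphabet, inner induction on the number of focused lines. Colours
  are natural numbers so that tuples of colours can be encoded as colours again.\<close>

theorem Hales_Jewett:
  fixes L :: "'a set" and K :: "nat set"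
  assumes "finite L" and "L \<noteq> {}" and "finite K"
  shows "\<exists>n. \<forall>\<chi>. range \<chi> \<subseteq> K \<longrightarrow> monochromatic_line L n \<chi>"
  using assms
proof (induction L arbitrary: K rule: finite_ne_induct)
  case (singleton z)
  have "[None] \<in> variable_words {z} 1"
    by (simp add: variable_words_def)
  then have "monochromatic_line {z} 1 \<chi>" for \<chi> :: "'a list \<Rightarrow> nat"
    unfolding monochromatic_line_def by blast
  then show ?case by blast
next
  case (insert z L)
  let ?L = "insert z L"
  obtain b0 where b0: "b0 \<in> L" using insert.hyps by blast
  have "\<exists>n. \<forall>\<chi>. range \<chi> \<subseteq> K \<longrightarrow> monochromatic_line ?L n \<chi> \<or> focused L z n \<chi> s" for s
  proof (induction s)
    case 0
    show ?case
      by (rule exI[of _ 0]) (simp add: focused_def words_def)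
  next
    case (Suc s)
    then obtain n where n:
      "\<And>\<chi>. range \<chi> \<subseteq> K \<Longrightarrow> monochromatic_line ?L n \<chi> \<or> focused L z n \<chi> s"
      by blast
    obtain ws where ws: "set ws = words ?L n"
      using finite_list[OF finite_words] insert.hyps by blast
    \<comment> \<open>A prefix is recoloured by the tuple of colours of all its continuations by
      words of length \<open>n\<close>. A line over \<open>L\<close> for this colouring is one on
      which every continuation keeps its colour.\<close>
    define K' where "K' = to_nat ` {cs. set cs \<subseteq> K \<and> length cs = length ws}"
    have "finite K'"
      unfolding K'_def using finite_lists_length_eq[OF insert.prems] by blast
    then obtain m where m: "\<And>\<chi>. range \<chi> \<subseteq> K' \<Longrightarrow> monochromatic_line L m \<chi>"
      using insert.IH by blast
    have "monochromatic_line ?L (m + n) \<chi> \<or> focused L z (m + n) \<chi> (Suc s)"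
      if \<chi>: "range \<chi> \<subseteq> K" for \<chi>
    proof (rule disjCI)
      assume no_line: "\<not> focused L z (m + n) \<chi> (Suc s)"
      define \<chi>' where "\<chi>' u = to_nat (map (\<lambda>w. \<chi> (u @ w)) ws)" for u
      have "range \<chi>' \<subseteq> K'"
        using \<chi> by (force simp: \<chi>'_def K'_def intro!: imageI)
      then obtain v c where v: "v \<in> variable_words L m"
        and c: "\<And>b. b \<in> L \<Longrightarrow> \<chi>' (subst_letter b v) = c"
        using m[of \<chi>'] unfolding monochromatic_line_def by blast
      have v_mono: "\<chi> (subst_letter b v @ w) = \<chi> (subst_letter b0 v @ w)"
        if "b \<in> L" "w \<in> words ?L n" for b w
        using c[OF that(1)] c[OF b0] that(2) by (auto simp: \<chi>'_def ws[symmetric])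
      have "range (\<lambda>w. \<chi> (subst_letter b0 v @ w)) \<subseteq> K"
        using \<chi> by blast
      then consider "monochromatic_line ?L n (\<lambda>w. \<chi> (subst_letter b0 v @ w))"
        | "focused L z n (\<lambda>w. \<chi> (subst_letter b0 v @ w)) s"
        using n[of "\<lambda>w. \<chi> (subst_letter b0 v @ w)"] by blast
      then show "monochromatic_line ?L (m + n) \<chi>"
      proof cases
        case 1
        then obtain u d where u: "u \<in> variable_words ?L n"
          and d: "\<And>b. b \<in> ?L \<Longrightarrow> \<chi> (subst_letter b0 v @ subst_letter b u) = d"
          unfolding monochromatic_line_def by blast
        have "subst_letter b0 v \<in> words ?L m"
          using subst_letter_in_words[OF v b0] by (auto simp: words_def)
        then have "map Some (subst_letter b0 v) @ u \<in> variable_words ?L (m + n)"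
          by (rule variable_words_append_constant(2)[OF u])
        then show ?thesis
          unfolding monochromatic_line_def
          by (intro bexI[where x = "map Some (subst_letter b0 v) @ u"] exI[where x = d]) (simp_all add: d)
      next
        case 2
        show ?thesis
          using focused_Suc[OF v b0 v_mono 2] no_line by blast
      qed
    qed
    then show ?case by blast
  qed
  then obtain n where n: "\<And>\<chi>. range \<chi> \<subseteq> K \<Longrightarrow>
      monochromatic_line ?L n \<chi> \<or> focused L z n \<chi> (Suc (card K))"
    by blast
  \<comment> \<open>More than \<open>card K\<close> pairwise distinct colours cannot lie in
    \<open>K\<close>.\<close>
  have "\<not> focused L z n \<chi> (Suc (card K))" if \<chi>: "range \<chi> \<subseteq> K" for \<chi>
  proof
    assume "focused L z n \<chi> (Suc (card K))"
    then obtain V c where c: "length c = Suc (card K)" "distinct c"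
      and Vc: "\<And>i b. i < Suc (card K) \<Longrightarrow> b \<in> L \<Longrightarrow> \<chi> (subst_letter b (V ! i)) = c ! i"
      unfolding focused_def by blast
    have "set c \<subseteq> K"
      using Vc[OF _ b0] c \<chi> by (metis in_set_conv_nth rangeI subset_iff)
    then have "card (set c) \<le> card K"
      using insert.prems by (rule card_mono[rotated])
    then show False
      using c by (simp add: distinct_card)
  qed
  then show ?case using n by blast
qed


section \<open>J-sets\<close>

lemma J_setE:
  fixes A :: "'a::comm_monoid_add set" and F :: "(nat \<Rightarrow> 'a) set"
  assumes "J_set A" and "finite F" and "F \<noteq> {}"
  obtains a H where "finite H" "H \<noteq> {}" "H \<subseteq> {1..}" "\<And>f. f \<in> F \<Longrightarrow> a + (\<Sum>t\<in>H. f t) \<in> A"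
proof -
  have "\<exists>a H. finite H \<and> H \<noteq> {} \<and> H \<subseteq> {1..} \<and> (\<forall>f\<in>F. a + (\<Sum>t\<in>H. f t) \<in> A)"
    using assms(1)[unfolded J_set_def, rule_format, OF conjI[OF assms(2,3)]] .
  then show thesis using that by blast
qed

lemma J_set_mono:
  fixes A B :: "'a::comm_monoid_add set"
  assumes "J_set A" and "A \<subseteq> B"
  shows "J_set B"
  unfolding J_set_def
proof (intro allI impI)
  fix F :: "(nat \<Rightarrow> 'a) set"
  assume "finite F \<and> F \<noteq> {}"
  then have F: "finite F" "F \<noteq> {}" by simp_all
  obtain a H where "finite H" "H \<noteq> {}" "H \<subseteq> {1..}"
    and "\<And>f. f \<in> F \<Longrightarrow> a + (\<Sum>t\<in>H. f t) \<in> A"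
    by (rule J_setE[OF assms(1) F]) blast
  then show "\<exists>a H. finite H \<and> H \<noteq> {} \<and> H \<subseteq> {1..} \<and> (\<forall>f\<in>F. a + (\<Sum>t\<in>H. f t) \<in> B)"
    using assms(2) by blast
qed

lemma not_J_setE:
  fixes A :: "'a::comm_monoid_add set"
  assumes "\<not> J_set A"
  obtains F :: "(nat \<Rightarrow> 'a) set" where "finite F" "F \<noteq> {}"
    "\<And>a H. finite H \<Longrightarrow> H \<noteq> {} \<Longrightarrow> H \<subseteq> {1..} \<Longrightarrow> \<exists>f\<in>F. a + (\<Sum>t\<in>H. f t) \<notin> A"
proof -
  obtain F :: "(nat \<Rightarrow> 'a) set" where F: "finite F" "F \<noteq> {}"
    and notA: "\<forall>a H. finite H \<and> H \<noteq> {} \<and> H \<subseteq> {1..} \<longrightarrow> (\<exists>f\<in>F. a + (\<Sum>t\<in>H. f t) \<notin> A)"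
    using assms unfolding J_set_def by meson
  show thesis
    by (rule that[OF F], rule notA[rule_format], intro conjI)
qed

lemma not_J_set_empty: "\<not> J_set ({} :: 'a::comm_monoid_add set)"
proof
  assume J: "J_set ({} :: 'a set)"
  have F: "finite {\<lambda>_::nat. 0::'a}" "{\<lambda>_::nat. 0::'a} \<noteq> {}" by simp_all
  show False by (rule J_setE[OF J F]) blast
qed

text \<open>The translation is absorbed into the free summand: \<open>a\<close> becomes
  \<open>a - c\<close>.\<close>

lemma J_set_translate:
  fixes A :: "'a::ab_group_add set"
  assumes "J_set ((+) c ` A)"
  shows "J_set A"
  unfolding J_set_def
proof (intro allI impI)
  fix F :: "(nat \<Rightarrow> 'a) set"
  assume "finite F \<and> F \<noteq> {}"
  then have F: "finite F" "F \<noteq> {}" by simp_all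
  obtain a H where H: "finite H" "H \<noteq> {}" "H \<subseteq> {1..}"
    and aH: "\<And>f. f \<in> F \<Longrightarrow> a + (\<Sum>t\<in>H. f t) \<in> (+) c ` A"
    by (rule J_setE[OF assms F]) blast
  have "(a - c) + (\<Sum>t\<in>H. f t) \<in> A" if f: "f \<in> F" for f
  proof -
    obtain z where "z \<in> A" "a + (\<Sum>t\<in>H. f t) = c + z"
      using aH[OF f] by blast
    moreover from this have "(a - c) + (\<Sum>t\<in>H. f t) = z"
      by (simp add: algebra_simps)
    ultimately show ?thesis by simp
  qed
  then show "\<exists>a H. finite H \<and> H \<noteq> {} \<and> H \<subseteq> {1..} \<and> (\<forall>f\<in>F. a + (\<Sum>t\<in>H. f t) \<in> A)"
    using H by blast
qed

section \<open>Partition regularity of J-sets\<close>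

text \<open>The indices are cut into blocks of length \<open>n\<close>. Fixed letters of
  \<open>v\<close> contribute a term independent of \<open>f\<close>; the variable positions pick
  out an index set over which \<open>f\<close> itself is summed. Division with remainder by
  \<open>n\<close> recovers the pair \<open>(t, i)\<close>.\<close>

lemma sum_subst_letter:
  fixes v :: "(nat \<Rightarrow> 'a::comm_monoid_add) option list"
  assumes "finite H" and n: "length v = n"
  defines "U \<equiv> {i. i < n \<and> v ! i = None}"
  shows "(\<Sum>t\<in>H. \<Sum>i<n. (subst_letter f v ! i) (n * t + i)) =
    (\<Sum>t\<in>H. \<Sum>i\<in>{..<n} - U. the (v ! i) (n * t + i)) +
    (\<Sum>k\<in>(\<lambda>(t, i). n * t + i) ` (H \<times> U). f k)"
proof -
  have U: "U \<subseteq> {..<n}" "finite U" by (auto simp: U_def)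
  have inj: "inj_on (\<lambda>(t, i). n * t + i) (H \<times> U)"
  proof (rule inj_onI, clarify)
    fix t i t' i'
    assume "i \<in> U" "i' \<in> U" and eq: "n * t + i = n * t' + i'"
    then have i: "i < n" "i' < n" by (auto simp: U_def)
    have "(n * t + i) mod n = i" "(n * t' + i') mod n = i'" using i by auto
    moreover have "(n * t + i) div n = t" "(n * t' + i') div n = t'" using i by auto
    ultimately show "t = t' \<and> i = i'" using eq by metis
  qed
  have "(\<Sum>i<n. (subst_letter f v ! i) (n * t + i)) =
      (\<Sum>i\<in>{..<n} - U. the (v ! i) (n * t + i)) + (\<Sum>i\<in>U. f (n * t + i))" for t
  proof -
    have "(\<Sum>i\<in>{..<n} - U. (subst_letter f v ! i) (n * t + i)) =
        (\<Sum>i\<in>{..<n} - U. the (v ! i) (n * t + i))"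
      using n by (intro sum.cong) (auto simp: U_def subst_letter_def)
    moreover have "(\<Sum>i\<in>U. (subst_letter f v ! i) (n * t + i)) = (\<Sum>i\<in>U. f (n * t + i))"
      using n by (intro sum.cong) (auto simp: U_def subst_letter_def)
    ultimately show ?thesis
      using sum.subset_diff[OF U(1), of "\<lambda>i. (subst_letter f v ! i) (n * t + i)"] by simp
  qed
  moreover have "(\<Sum>t\<in>H. \<Sum>i\<in>U. f (n * t + i)) =
      (\<Sum>k\<in>(\<lambda>(t, i). n * t + i) ` (H \<times> U). f k)"
    by (subst sum.reindex[OF inj]) (simp add: sum.cartesian_product case_prod_unfold)
  ultimately show ?thesis
    by (simp add: sum.distrib)
qed

text \<open>If neither part were a J-set, the two finite families witnessing this would together
  form an alphabet. Block sums turn words over it into sequences, and a line whose sums all lie in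
  \<open>A\<close>, or all in \<open>B\<close>, contradicts one of the witnesses.\<close>

theorem J_set_Un:
  fixes A B :: "'a::comm_monoid_add set"
  assumes "J_set (A \<union> B)"
  shows "J_set A \<or> J_set B"
proof (rule ccontr)
  assume "\<not> (J_set A \<or> J_set B)"
  then have nJ: "\<not> J_set A" "\<not> J_set B" by simp_all
  obtain FA :: "(nat \<Rightarrow> 'a) set" where FA: "finite FA" "FA \<noteq> {}"
    and notA: "\<And>a H. finite H \<Longrightarrow> H \<noteq> {} \<Longrightarrow> H \<subseteq> {1..} \<Longrightarrow> \<exists>f\<in>FA. a + (\<Sum>t\<in>H. f t) \<notin> A"
    using not_J_setE[OF nJ(1)] by blast
  obtain FB :: "(nat \<Rightarrow> 'a) set" where FB: "finite FB" "FB \<noteq> {}"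
    and notB: "\<And>a H. finite H \<Longrightarrow> H \<noteq> {} \<Longrightarrow> H \<subseteq> {1..} \<Longrightarrow> \<exists>f\<in>FB. a + (\<Sum>t\<in>H. f t) \<notin> B"
    using not_J_setE[OF nJ(2)] by blast
  define F where "F = FA \<union> FB"
  have F: "finite F" "F \<noteq> {}" using FA FB by (auto simp: F_def)
  obtain n where n: "\<And>\<chi>. range \<chi> \<subseteq> {0, 1::nat} \<Longrightarrow> monochromatic_line F n \<chi>"
    using Hales_Jewett[OF F, of "{0, 1}"] by auto
  define g where "g w t = (\<Sum>i<n. (w ! i) (n * t + i))" for w :: "(nat \<Rightarrow> 'a) list" and t
  obtain f0 where "f0 \<in> F" using F by blast
  then have "replicate n f0 \<in> words F n" by (auto simp: words_def)
  then have g: "finite (g ` words F n)" "g ` words F n \<noteq> {}"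
    using finite_words[OF F(1)] by auto
  obtain a H where H: "finite H" "H \<noteq> {}" "H \<subseteq> {1..}"
    and aH: "\<And>w. w \<in> words F n \<Longrightarrow> a + (\<Sum>t\<in>H. g w t) \<in> A \<union> B"
    by (rule J_setE[OF assms g]) blast
  define \<chi> where "\<chi> w = (if a + (\<Sum>t\<in>H. g w t) \<in> A then 0 else 1 :: nat)" for w
  have "range \<chi> \<subseteq> {0, 1}" by (auto simp: \<chi>_def)
  then obtain v c where v: "v \<in> variable_words F n"
    and c: "\<And>f. f \<in> F \<Longrightarrow> \<chi> (subst_letter f v) = c"
    using n[of \<chi>] unfolding monochromatic_line_def by blast
  have len: "length v = n" using v by (simp add: variable_words_def)
  define U where "U = {i. i < n \<and> v ! i = None}"
  have "U \<noteq> {}" "finite U"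
    using v by (auto simp: variable_words_def U_def in_set_conv_nth)
  define H' where "H' = (\<lambda>(t, i). n * t + i) ` (H \<times> U)"
  define a' where "a' = a + (\<Sum>t\<in>H. \<Sum>i\<in>{..<n} - U. the (v ! i) (n * t + i))"
  have H': "finite H'" "H' \<noteq> {}" "H' \<subseteq> {1..}"
  proof -
    show "finite H'" "H' \<noteq> {}"
      using H \<open>U \<noteq> {}\<close> \<open>finite U\<close> by (auto simp: H'_def)
    \<comment> \<open>Index \<open>0\<close> is avoided because the block numbers in
      \<open>H\<close> are positive and so is \<open>n\<close>.\<close>
    show "H' \<subseteq> {1..}"
    proof
      fix k assume "k \<in> H'"
      then obtain t i where k: "k = n * t + i" "t \<in> H" "i < n" by (auto simp: H'_def U_def)
      then have "0 < t" using H(3) by auto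
      then have "0 < n * t" using k(3) by simp
      then have "1 \<le> k" using k(1) by linarith
      then show "k \<in> {1..}" by simp
    qed
  qed
  have eq: "a + (\<Sum>t\<in>H. g (subst_letter f v) t) = a' + (\<Sum>k\<in>H'. f k)" for f
    unfolding g_def a'_def H'_def U_def sum_subst_letter[OF H(1) len] by (simp add: add.assoc)
  have AB: "a' + (\<Sum>k\<in>H'. f k) \<in> A \<union> B" if "f \<in> F" for f
    using aH[OF subst_letter_in_words[OF v that]] by (simp add: eq)
  show False
  proof (cases "c = 0")
    case True
    then have "a' + (\<Sum>k\<in>H'. f k) \<in> A" if "f \<in> F" for f
      using c[OF that] by (auto simp: \<chi>_def eq split: if_splits)
    then show False using notA[OF H', of a'] by (auto simp: F_def)
  next
    case False
    then have "a' + (\<Sum>k\<in>H'. f k) \<notin> A" if "f \<in> F" for f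
      using c[OF that] by (auto simp: \<chi>_def eq split: if_splits)
    then show False using notB[OF H', of a'] AB by (auto simp: F_def)
  qed
qed

section \<open>Tails of finite sums of Gaussian integers\<close>

text \<open>Transfers characteristic zero from the complex numbers to the Gaussian integers.\<close>

lemma complex_of_gauss_int_of_nat: "complex_of_gauss_int (of_nat n) = of_nat n"
  by (induction n) (simp_all add: zero_gauss_int.rep_eq one_gauss_int.rep_eq plus_gauss_int.rep_eq)

text \<open>The constant sequences \<open>0\<close> and \<open>1\<close> would give
  \<open>a = c\<close> and \<open>a + of_nat (card H) = c\<close> with \<open>H\<close> nonempty,
  which is impossible in characteristic zero.\<close>

lemma not_J_set_singleton: "\<not> J_set {c :: gauss_int}"
proof
  assume J: "J_set {c}"
  define F :: "(nat \<Rightarrow> gauss_int) set" where "F = {\<lambda>_. 0, \<lambda>_. 1}"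
  then have F: "finite F" "F \<noteq> {}" by simp_all
  obtain a H where H: "finite H" "H \<noteq> {}"
    and aH: "\<And>f. f \<in> F \<Longrightarrow> a + (\<Sum>t\<in>H. f t) \<in> {c}"
    by (rule J_setE[OF J F]) blast
  have "a = c" "a + of_nat (card H) = c"
    using aH[of "\<lambda>_. 0"] aH[of "\<lambda>_. 1"] by (simp_all add: F_def)
  then have "(of_nat (card H) :: gauss_int) = of_nat 0" by auto
  then have "(of_nat (card H) :: complex) = of_nat 0"
    by (metis complex_of_gauss_int_of_nat)
  then show False using H by (simp only: of_nat_eq_iff) simp
qed

lemma FS_subset_Suc: "FS x m \<subseteq> FS x (Suc m) \<union> ({x m} \<union> (+) (x m) ` FS x (Suc m))"
proof
  fix z assume "z \<in> FS x m"
  then obtain F where F: "finite F" "F \<noteq> {}" "F \<subseteq> {m..}" and z: "z = (\<Sum>n\<in>F. x n)"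
    by (auto simp: FS_def)
  have *: "F - {m} \<subseteq> {Suc m..}"
    using F by (auto simp: Suc_le_eq le_neq_implies_less)
  consider "m \<notin> F" | "F = {m}" | "m \<in> F" "F - {m} \<noteq> {}" by blast
  then show "z \<in> FS x (Suc m) \<union> ({x m} \<union> (+) (x m) ` FS x (Suc m))"
  proof cases
    case 1
    then have "F \<subseteq> {Suc m..}" using * by simp
    then show ?thesis using F z by (auto simp: FS_def)
  next
    case 2
    then show ?thesis using z by simp
  next
    case 3
    then have "z = x m + (\<Sum>n\<in>F - {m}. x n)" using z F by (simp add: sum.remove)
    moreover have "(\<Sum>n\<in>F - {m}. x n) \<in> FS x (Suc m)" using 3 F * by (auto simp: FS_def)
    ultimately show ?thesis by blast
  qed
qed

lemma J_set_FS:
  fixes x :: "nat \<Rightarrow> gauss_int"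
  assumes "J_set (FS x 1)"
  shows "J_set (FS x (Suc m))"
proof (induction m)
  case 0
  then show ?case using assms by simp
next
  case (Suc m)
  \<comment> \<open>Partition regularity is applied twice to three pieces. The singleton is
    excluded, and each other piece yields the next tail, one of them by translation.\<close>
  show ?case
    using J_set_Un[OF J_set_mono[OF Suc FS_subset_Suc]] J_set_Un[of "{x (Suc m)}"]
      not_J_set_singleton J_set_translate by blast
qed


section \<open>Additive filters and idempotent ultrafilters\<close>

text \<open>Filters with \<open>p \<oplus>\<^sub>\<beta> p \<le> p\<close> generalise closed subsemigroups of \<open>\<beta>S\<close>. A minimal proper one is an
  idempotent ultrafilter, which is the Ellis--Numakura argument of Di Nasso and Tachtsis.\<close>

lemma eventually_beta_add_iff:
  "eventually P (p \<oplus>\<^sub>\<beta> q) \<longleftrightarrow> (\<forall>\<^sub>F x in p. \<forall>\<^sub>F y in q. P (x + y))"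
  using eventually_beta_add[of "{z. P z}" p q] by (simp add: left_shift_def)

lemma beta_add_assoc:
  fixes p q r :: "'a::semigroup_add filter"
  shows "(p \<oplus>\<^sub>\<beta> q) \<oplus>\<^sub>\<beta> r = p \<oplus>\<^sub>\<beta> (q \<oplus>\<^sub>\<beta> r)"
  by (simp add: filter_eq_iff eventually_beta_add_iff add.assoc)

lemma beta_add_mono: "p \<le> p' \<Longrightarrow> q \<le> q' \<Longrightarrow> p \<oplus>\<^sub>\<beta> q \<le> p' \<oplus>\<^sub>\<beta> q'"
  unfolding le_filter_def eventually_beta_add_iff by (blast intro: eventually_mono)

lemma beta_add_eq_bot_iff: "p \<oplus>\<^sub>\<beta> q = bot \<longleftrightarrow> p = bot \<or> q = bot"
  by (cases "q = bot") (simp_all add: trivial_limit_def eventually_beta_add_iff)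

section \<open>Minimal filters and ultrafilters\<close>

lemma filter_Zorn:
  fixes p :: "'a filter"
  assumes "p \<noteq> bot" and "Q p"
    and Inf: "\<And>C. C \<noteq> {} \<Longrightarrow> (\<And>q. q \<in> C \<Longrightarrow> Q q) \<Longrightarrow> Q (Inf C)"
  obtains q where "q \<le> p" "q \<noteq> bot" "Q q" "\<And>r. r \<le> q \<Longrightarrow> r \<noteq> bot \<Longrightarrow> Q r \<Longrightarrow> r = q"
proof -
  define M where "M = {q. q \<le> p \<and> q \<noteq> bot \<and> Q q}"
  have "\<exists>m\<in>M. \<forall>a\<in>M. a \<le> m \<longrightarrow> a = m"
  \<comment> \<open>The order is reversed, so that maximal elements are minimal filters.\<close>
  proof (rule predicate_Zorn)
    show "partial_order_on M (relation_of (\<lambda>a b. b \<le> a) M)"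
      by (auto simp: partial_order_on_def preorder_on_def refl_on_def trans_def antisym_def
          relation_of_def)
  next
    fix C assume C: "C \<in> Chains (relation_of (\<lambda>a b. b \<le> a) M)"
    show "\<exists>u\<in>M. \<forall>a\<in>C. u \<le> a"
    proof (cases "C = {}")
      case True
      then show ?thesis using assms by (auto simp: M_def)
    next
      case False
      have CM: "C \<subseteq> M" and chain: "\<And>a b. a \<in> C \<Longrightarrow> b \<in> C \<Longrightarrow> a \<le> b \<or> b \<le> a"
        using C by (auto simp: Chains_def relation_of_def)
      \<comment> \<open>A chain is directed downwards, so its members form a base of the infimum,
        which therefore stays proper.\<close>
      have "\<exists>c\<in>C. c \<le> inf a b" if "a \<in> C" "b \<in> C" for a b
        using chain[OF that] that by (auto simp: inf_absorb1 inf_absorb2)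
      then have "eventually P (Inf C) \<longleftrightarrow> (\<exists>a\<in>C. eventually P a)" for P
        using False by (intro eventually_Inf_base) auto
      then have "Inf C \<noteq> bot"
        using CM unfolding trivial_limit_def M_def by (auto simp: trivial_limit_def)
      moreover have "Inf C \<le> p"
        using False CM by (auto simp: M_def intro: Inf_lower2)
      moreover have "Q (Inf C)"
        using False CM by (intro Inf) (auto simp: M_def)
      ultimately have "Inf C \<in> M" by (simp add: M_def)
      then show ?thesis by (auto intro: Inf_lower)
    qed
  qed
  then obtain q where "q \<in> M" "\<And>a. a \<in> M \<Longrightarrow> a \<le> q \<Longrightarrow> a = q" by blast
  then show thesis
    by (intro that[of q]) (auto simp: M_def)
qed

text \<open>A minimal proper filter decides every \<open>A\<close>: restricting it to
  \<open>A\<close> gives either \<open>bot\<close>, so that it contains \<open>- A\<close>, or the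
  same filter, so that it contains \<open>A\<close>.\<close>

lemma ultrafilter_below:
  fixes p :: "'a filter"
  assumes "p \<noteq> bot"
  obtains q where "q \<le> p" "ultrafilter q"
proof -
  obtain q where q: "q \<le> p" "q \<noteq> bot" and min: "\<And>r. r \<le> q \<Longrightarrow> r \<noteq> bot \<Longrightarrow> r = q"
    using filter_Zorn[of p "\<lambda>_. True"] assms by auto
  have "(\<forall>\<^sub>F x in q. x \<in> A) \<or> (\<forall>\<^sub>F x in q. x \<in> - A)" for A
  proof (cases "inf q (principal A) = bot")
    case True
    then show ?thesis by (simp add: trivial_limit_def eventually_inf_principal)
  next
    case False
    then have "inf q (principal A) = q" by (intro min) auto
    then show ?thesis by (metis inf.cobounded2 le_principal)
  qed
  then show thesis using that q by (simp add: ultrafilter_def)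
qed

text \<open>For an ultrafilter \<open>w\<close>, this corresponds to the closed set of all ultrafilters \<open>q \<le> p\<close>
  with \<open>q \<oplus>\<^sub>\<beta> w = w\<close>.\<close>

definition stabilizer :: "'a::plus filter \<Rightarrow> 'a filter \<Rightarrow> 'a filter" where
  "stabilizer p w = Abs_filter (\<lambda>P. \<exists>B A. eventually B p \<and> eventually A w \<and>
     (\<forall>x. B x \<longrightarrow> (\<forall>\<^sub>F y in w. A (x + y)) \<longrightarrow> P x))"

lemma eventually_stabilizer:
  "eventually P (stabilizer p w) \<longleftrightarrow> (\<exists>B A. eventually B p \<and> eventually A w \<and>
     (\<forall>x. B x \<longrightarrow> (\<forall>\<^sub>F y in w. A (x + y)) \<longrightarrow> P x))"
  unfolding stabilizer_def
proof (rule eventually_Abs_filter, rule is_filter.intro, goal_cases)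
  case 1
  show ?case by (intro exI[of _ "\<lambda>_. True"]) simp
next
  case (2 P Q)
  then obtain B A B' A' where "eventually B p" "eventually A w" "eventually B' p" "eventually A' w"
    and "\<forall>x. B x \<longrightarrow> (\<forall>\<^sub>F y in w. A (x + y)) \<longrightarrow> P x"
    and "\<forall>x. B' x \<longrightarrow> (\<forall>\<^sub>F y in w. A' (x + y)) \<longrightarrow> Q x" by blast
  then show ?case
    by (intro exI[of _ "\<lambda>x. B x \<and> B' x"] exI[of _ "\<lambda>x. A x \<and> A' x"])
      (auto simp: eventually_conj_iff)
next
  case (3 P Q)
  then show ?case by blast
qed

text \<open>For an ultrafilter \<open>w\<close> below \<open>p\<close>, both
  \<open>p \<oplus>\<^sub>\<beta> w\<close> and the stabilizer of \<open>w\<close> are proper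
  additive filters below \<open>p\<close>. By minimality both equal \<open>p\<close>, which forces
  \<open>p = w\<close>.\<close>

lemma minimal_additive_filter:
  fixes p :: "'a::semigroup_add filter"
  assumes "p \<noteq> bot" and add: "p \<oplus>\<^sub>\<beta> p \<le> p"
    and min: "\<And>r. r \<le> p \<Longrightarrow> r \<noteq> bot \<Longrightarrow> r \<oplus>\<^sub>\<beta> r \<le> r \<Longrightarrow> r = p"
  shows "ultrafilter p" and "p \<oplus>\<^sub>\<beta> p = p"
proof -
  obtain w where w: "w \<le> p" "ultrafilter w"
    using ultrafilter_below assms(1) by blast
  have "w \<noteq> bot" using w by (simp add: ultrafilter_def)
  have pw: "p \<oplus>\<^sub>\<beta> w = p"
  proof (rule min)
    show "p \<oplus>\<^sub>\<beta> w \<le> p"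
      using add beta_add_mono[OF order_refl w(1)] by (rule order_trans[rotated])
    show "p \<oplus>\<^sub>\<beta> w \<noteq> bot"
      using assms(1) \<open>w \<noteq> bot\<close> by (simp add: beta_add_eq_bot_iff)
    have "(p \<oplus>\<^sub>\<beta> w) \<oplus>\<^sub>\<beta> (p \<oplus>\<^sub>\<beta> w) \<le> (p \<oplus>\<^sub>\<beta> p) \<oplus>\<^sub>\<beta> (p \<oplus>\<^sub>\<beta> w)"
      using w by (intro beta_add_mono) auto
    also have "\<dots> \<le> p \<oplus>\<^sub>\<beta> (p \<oplus>\<^sub>\<beta> w)"
      using add by (intro beta_add_mono) auto
    also have "\<dots> = (p \<oplus>\<^sub>\<beta> p) \<oplus>\<^sub>\<beta> w"
      by (simp add: beta_add_assoc)
    also have "\<dots> \<le> p \<oplus>\<^sub>\<beta> w"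
      using add by (intro beta_add_mono) auto
    finally show "(p \<oplus>\<^sub>\<beta> w) \<oplus>\<^sub>\<beta> (p \<oplus>\<^sub>\<beta> w) \<le> p \<oplus>\<^sub>\<beta> w" .
  qed
  let ?d = "stabilizer p w"
  have dp: "?d \<le> p"
    unfolding le_filter_def eventually_stabilizer using eventually_True by blast
  have star: "\<forall>\<^sub>F x in ?d. \<forall>\<^sub>F y in w. A (x + y)" if "eventually A w" for A
    unfolding eventually_stabilizer using that eventually_True by blast
  have "?d = p"
  proof (rule min[OF dp])
    show "?d \<noteq> bot"
    proof
      assume "?d = bot"
      then obtain B A where "eventually B p" and A: "eventually A w"
        and BA: "\<And>x. B x \<Longrightarrow> \<not> (\<forall>\<^sub>F y in w. A (x + y))"
        using eventually_stabilizer[of "\<lambda>_. False" p w] by auto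
      \<comment> \<open>As \<open>w\<close> is an ultrafilter, failure to hold eventually is
        eventual failure. Thus the complement of \<open>A\<close> belongs to
        \<open>p \<oplus>\<^sub>\<beta> w = p\<close> and hence to \<open>w\<close>.\<close>
      have "\<forall>\<^sub>F y in w. \<not> A (x + y)" if "B x" for x
        using w(2) BA[OF that] by (auto simp: ultrafilter_def dest: spec[of _ "{y. A (x + y)}"])
      then have "eventually (\<lambda>z. \<not> A z) (p \<oplus>\<^sub>\<beta> w)"
        unfolding eventually_beta_add_iff using \<open>eventually B p\<close> by (rule eventually_mono[rotated])
      then have "eventually (\<lambda>z. \<not> A z) w"
        using pw w(1) by (simp add: filter_leD)
      with A have "eventually (\<lambda>_. False) w" by eventually_elim simp
      then show False using \<open>w \<noteq> bot\<close> by simp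
    qed
    show "?d \<oplus>\<^sub>\<beta> ?d \<le> ?d"
    proof (rule filter_leI)
      fix P assume "eventually P ?d"
      then obtain B A where B: "eventually B p" and A: "eventually A w"
        and P: "\<And>x. B x \<Longrightarrow> (\<forall>\<^sub>F y in w. A (x + y)) \<Longrightarrow> P x"
        unfolding eventually_stabilizer by blast
      have "eventually B (p \<oplus>\<^sub>\<beta> p)" using B add by (rule filter_leD[rotated])
      then have "eventually B (?d \<oplus>\<^sub>\<beta> ?d)" using beta_add_mono[OF dp dp] filter_leD by blast
      \<comment> \<open>\<open>star\<close> is used twice: first for \<open>A\<close>, then for the
        shifts of \<open>A\<close> that it shows to belong to \<open>w\<close>.\<close>
      moreover have "eventually (\<lambda>z. \<forall>\<^sub>F y in w. A (z + y)) (?d \<oplus>\<^sub>\<beta> ?d)"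
        unfolding eventually_beta_add_iff using star[OF A]
        by eventually_elim (use star in \<open>simp add: add.assoc\<close>)
      ultimately show "eventually P (?d \<oplus>\<^sub>\<beta> ?d)"
        by eventually_elim (rule P)
    qed
  qed
  \<comment> \<open>With the stabilizer equal to \<open>p\<close>, \<open>star\<close> says that
    \<open>A\<close> belongs to \<open>p \<oplus>\<^sub>\<beta> w\<close>, which is
    \<open>p\<close>.\<close>
  then have "eventually A p" if "eventually A w" for A
    using star[OF that] pw by (metis eventually_beta_add_iff)
  then have "p \<le> w" by (rule filter_leI)
  then have "p = w" using w(1) by simp
  then show "ultrafilter p" "p \<oplus>\<^sub>\<beta> p = p" using w(2) pw by auto
qed

text \<open>Additivity passes to infima by monotonicity of the operation, so Zorn's lemma yields a
  minimal additive filter.\<close>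

theorem idempotent_ultrafilter_below:
  fixes p :: "'a::semigroup_add filter"
  assumes "p \<noteq> bot" and "p \<oplus>\<^sub>\<beta> p \<le> p"
  obtains q where "q \<le> p" "q \<in> beta" "q \<oplus>\<^sub>\<beta> q = q"
proof (rule filter_Zorn[of p "\<lambda>q. q \<oplus>\<^sub>\<beta> q \<le> q"])
  fix C :: "'a filter set"
  assume "\<And>q. q \<in> C \<Longrightarrow> q \<oplus>\<^sub>\<beta> q \<le> q"
  then show "Inf C \<oplus>\<^sub>\<beta> Inf C \<le> Inf C"
    by (meson Inf_greatest Inf_lower beta_add_mono order_trans)
next
  fix q assume "q \<le> p" "q \<noteq> bot" "q \<oplus>\<^sub>\<beta> q \<le> q"
    and "\<And>r. r \<le> q \<Longrightarrow> r \<noteq> bot \<Longrightarrow> r \<oplus>\<^sub>\<beta> r \<le> r \<Longrightarrow> r = q"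
  then show thesis
    using that minimal_additive_filter[of q] by (auto simp: beta_def)
qed (use assms in auto)


section \<open>Almost minimal sequences\<close>

text \<open>This filter corresponds to the closed set of all \<open>p\<close> in \<open>J(S)\<close> that contain every
  \<open>FS x (Suc m)\<close>.\<close>

definition FS_J_filter :: "(nat \<Rightarrow> 'a::comm_monoid_add) \<Rightarrow> 'a filter" where
  "FS_J_filter x = Abs_filter (\<lambda>P. \<exists>m. \<not> J_set (FS x (Suc m) \<inter> {z. \<not> P z}))"

lemma FS_antimono: "m \<le> n \<Longrightarrow> FS x n \<subseteq> FS x m"
  unfolding FS_def by (blast intro: atLeast_subset_iff[THEN iffD2] order_trans)

text \<open>Closure under conjunction is partition regularity: on the later of the two tails, the
  failures of \<open>P\<close> and of \<open>Q\<close> are two sets that are not J-sets, and so is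
  their union.\<close>

lemma eventually_FS_J_filter:
  "eventually P (FS_J_filter x) \<longleftrightarrow> (\<exists>m. \<not> J_set (FS x (Suc m) \<inter> {z. \<not> P z}))"
  unfolding FS_J_filter_def
proof (rule eventually_Abs_filter, rule is_filter.intro, goal_cases)
  case 1
  show ?case by (simp add: not_J_set_empty)
next
  case (2 P Q)
  then obtain m n where m: "\<not> J_set (FS x (Suc m) \<inter> {z. \<not> P z})"
    and n: "\<not> J_set (FS x (Suc n) \<inter> {z. \<not> Q z})" by blast
  have "FS x (Suc (max m n)) \<inter> {z. \<not> (P z \<and> Q z)} \<subseteq>
      (FS x (Suc m) \<inter> {z. \<not> P z}) \<union> (FS x (Suc n) \<inter> {z. \<not> Q z})"
    using FS_antimono[of "Suc m" "Suc (max m n)" x] FS_antimono[of "Suc n" "Suc (max m n)" x]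
    by auto
  then show ?case using m n J_set_Un J_set_mono by blast
next
  case (3 P Q)
  then obtain m where m: "\<not> J_set (FS x (Suc m) \<inter> {z. \<not> P z})" by blast
  have "FS x (Suc m) \<inter> {z. \<not> Q z} \<subseteq> FS x (Suc m) \<inter> {z. \<not> P z}" using 3 by blast
  then show ?case using m J_set_mono by blast
qed

text \<open>A fixed \<open>z\<close> in a tail of finite sums shifts some later tail into that same
  tail. Translation invariance then carries smallness of the exceptional set for \<open>P\<close>
  over to the shifted predicate.\<close>

lemma FS_J_filter_additive:
  fixes x :: "nat \<Rightarrow> 'a::ab_group_add"
  shows "FS_J_filter x \<oplus>\<^sub>\<beta> FS_J_filter x \<le> FS_J_filter x"
proof (rule filter_leI)
  fix P assume "eventually P (FS_J_filter x)"
  then obtain m where m: "\<not> J_set (FS x (Suc m) \<inter> {z. \<not> P z})"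
    unfolding eventually_FS_J_filter by blast
  have "\<forall>\<^sub>F y in FS_J_filter x. P (z + y)" if z: "z \<in> FS x (Suc m)" for z
  proof -
    obtain F where F: "finite F" "F \<noteq> {}" "F \<subseteq> {Suc m..}" "z = (\<Sum>n\<in>F. x n)"
      using z by (auto simp: FS_def)
    \<comment> \<open>Starting past every index used by \<open>z\<close> keeps the index sets
      disjoint.\<close>
    let ?k = "Suc (Max F)"
    have "z + y \<in> FS x (Suc m)" if y: "y \<in> FS x ?k" for y
    proof -
      obtain G where G: "finite G" "G \<noteq> {}" "G \<subseteq> {?k..}" "y = (\<Sum>n\<in>G. x n)"
        using y by (auto simp: FS_def)
      have "F \<inter> G = {}"
      proof (rule ccontr)
        assume "F \<inter> G \<noteq> {}"
        then obtain i where "i \<in> F" "i \<in> G" by blast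
        then show False using G(3) Max_ge[OF F(1), of i] by auto
      qed
      then have "z + y = (\<Sum>n\<in>F \<union> G. x n)"
        using F G by (simp add: sum.union_disjoint)
      moreover have "G \<subseteq> {Suc m..}"
      proof -
        have "Suc m \<le> Max F" using F by (meson Max_in atLeast_iff subset_iff)
        then show ?thesis using G(3) by auto
      qed
      ultimately show ?thesis
        using F G unfolding FS_def by (blast intro: finite_UnI)
    qed
    then have "(+) z ` (FS x ?k \<inter> {y. \<not> P (z + y)}) \<subseteq> FS x (Suc m) \<inter> {z. \<not> P z}"
      by auto
    then have nJ: "\<not> J_set ((+) z ` (FS x ?k \<inter> {y. \<not> P (z + y)}))"
      using m J_set_mono by blast
    have "\<not> J_set (FS x ?k \<inter> {y. \<not> P (z + y)})"
    proof
      assume J: "J_set (FS x ?k \<inter> {y. \<not> P (z + y)})"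
      \<comment> \<open>Translating back by \<open>- z\<close> gives the converse direction of
        translation invariance.\<close>
      have "(+) (- z) ` (+) z ` B = B" for B :: "'a set" by (simp add: image_image)
      then show False using J nJ J_set_translate[of "- z"] by metis
    qed
    then show ?thesis unfolding eventually_FS_J_filter by blast
  qed
  then have "FS x (Suc m) \<inter> {z. \<not> (\<forall>\<^sub>F y in FS_J_filter x. P (z + y))} = {}" by blast
  then have "\<not> J_set (FS x (Suc m) \<inter> {z. \<not> (\<forall>\<^sub>F y in FS_J_filter x. P (z + y))})"
    using not_J_set_empty by simp
  then have "\<forall>\<^sub>F z in FS_J_filter x. \<forall>\<^sub>F y in FS_J_filter x. P (z + y)"
    using eventually_FS_J_filter[of "\<lambda>z. \<forall>\<^sub>F y in FS_J_filter x. P (z + y)"] by blast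
  then show "eventually P (FS_J_filter x \<oplus>\<^sub>\<beta> FS_J_filter x)"
    by (simp add: eventually_beta_add_iff)
qed

lemma below_FS_J_filter:
  assumes "p \<in> beta" and "p \<le> FS_J_filter x"
  shows "p \<in> (\<Inter>m\<in>{1..}. beta_closure (FS x m)) \<inter> J_ultrafilters"
proof -
  have "\<forall>\<^sub>F z in p. z \<in> FS x m" if "m \<in> {1..}" for m
  proof -
    \<comment> \<open>Here \<open>Suc (m - 1) = m\<close> since \<open>m\<close> is at least
      \<open>1\<close>, so the intersection is empty.\<close>
    have "\<not> J_set (FS x (Suc (m - 1)) \<inter> {z. z \<notin> FS x m})"
      using that not_J_set_empty by (simp add: Int_def)
    then show ?thesis
      using assms(2) eventually_FS_J_filter filter_leD by blast
  qed
  moreover have "J_set A" if A: "\<forall>\<^sub>F z in p. z \<in> A" for A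
  proof (rule ccontr)
    assume "\<not> J_set A"
    \<comment> \<open>The complement of a set that is not a J-set belongs to
      \<open>FS_J_filter x\<close>.\<close>
    then have "\<not> J_set (FS x (Suc 0) \<inter> {z. \<not> z \<notin> A})"
      using J_set_mono by (metis (no_types, lifting) IntE mem_Collect_eq subsetI)
    then have "\<forall>\<^sub>F z in p. z \<notin> A"
      using assms(2) eventually_FS_J_filter filter_leD by blast
    with A have "\<forall>\<^sub>F z in p. False" by eventually_elim simp
    then show False using assms(1) by (simp add: beta_def ultrafilter_def)
  qed
  ultimately show ?thesis
    using assms(1) by (auto simp: beta_closure_def J_ultrafilters_def)
qed

theorem theorem2p13:
  fixes x :: "nat \<Rightarrow> gauss_int"
  shows "(almost_minimal x \<longleftrightarrow> J_set (FS x 1)) \<and>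
    (J_set (FS x 1) \<longleftrightarrow>
      (\<exists>p \<in> beta. p \<oplus>\<^sub>\<beta> p = p \<and>
         p \<in> (\<Inter>m\<in>{1..}. beta_closure (FS x m)) \<inter> J_ultrafilters))"
proof -
  have "\<exists>p \<in> beta. p \<oplus>\<^sub>\<beta> p = p \<and>
      p \<in> (\<Inter>m\<in>{1..}. beta_closure (FS x m)) \<inter> J_ultrafilters" if "J_set (FS x 1)"
  proof -
    \<comment> \<open>The filter could be improper only if some tail were not a J-set.\<close>
    have "FS_J_filter x \<noteq> bot"
      using J_set_FS[OF that] by (simp add: trivial_limit_def eventually_FS_J_filter)
    then obtain p where "p \<le> FS_J_filter x" "p \<in> beta" "p \<oplus>\<^sub>\<beta> p = p"
      using idempotent_ultrafilter_below FS_J_filter_additive by blast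
    then show ?thesis using below_FS_J_filter by blast
  qed
  \<comment> \<open>The tail \<open>m = 1\<close> belongs to an ultrafilter all of whose members are
    J-sets.\<close>
  moreover have "J_set (FS x 1)" if "almost_minimal x"
    using that unfolding almost_minimal_def J_ultrafilters_def beta_closure_def by fastforce
  ultimately show ?thesis
    unfolding almost_minimal_def by blast
qed

end
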